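(* The set $S$ contains $$\bigcup_{n\in\mathbf{Z}_+,\; r\in\{0,\dots,2^{n+2}\}} e^{\pi i r/2^{n+1}}\,[0,2^{1/2^n}].$$ Hence $S$ contains the unit disc $\{\lambda\in\mathbf{C}:|\lambda|\le 1\}$.
   Context: $\mathbf{Z}_+$ denotes the non-negative integers. For $z\in\mathbf{C}$ and an interval $J\subset\mathbf{R}$, $zJ=\{zt:t\in J\}$. Let $\Omega=\{\pm1\}^{\mathbf{Z}}$. For $c\in\Omega$, $A_c$ is the bounded operator on $\ell^2(\mathbf{Z})$ given by $(A_cf)_n=c_nf_{n-1}+f_{n+1}$, and $\mathrm{Spec}(A_c)$ is its spectrum. A sequence $c\in\Omega$ is pseudo-ergodic if for every finite sequence $b:\{1,\dots,n\}\to\{\pm1\}$ there exists $m\in\mathbf{Z}$ with $b_r=c_{m+r}$ for all $r\in\{1,\dots,n\}$. It is known that $\mathrm{Spec}(A_c)$ is the same set for all pseudo-ergodic $c\in\Omega$; this common set is denoted $S$. (It is also known that $S=\bigcup_{b\in\Omega}\mathrm{Spec}(A_b)$.) *)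

theory Defs
  imports "HOL-Analysis.Analysis" "HOL-Library.Discrete_Functions"
begin

section \<open>The Hilbert space of square-summable bi-infinite sequences\<close>

definition l2 :: "(int \<Rightarrow> complex) set" where
  "l2 = {f. (\<lambda>n. (cmod (f n))\<^sup>2) summable_on UNIV}"

text \<open>Only meaningful on \<^const>\<open>l2\<close>: the infinite sum is 0 for families that are not summable.\<close>
definition l2norm :: "(int \<Rightarrow> complex) \<Rightarrow> real" where
  "l2norm f = sqrt (\<Sum>\<^sub>\<infinity>n. (cmod (f n))\<^sup>2)"

text \<open>Operators on \<^const>\<open>l2\<close> are represented by functions on all bi-infinite sequences; only
  their values on \<^const>\<open>l2\<close> matter.\<close>

definition bounded_operator :: "((int \<Rightarrow> complex) \<Rightarrow> (int \<Rightarrow> complex)) \<Rightarrow> bool" where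
  "bounded_operator T \<longleftrightarrow>
     (\<forall>f\<in>l2. T f \<in> l2) \<and>
     (\<forall>f\<in>l2. \<forall>g\<in>l2. T (\<lambda>n. f n + g n) = (\<lambda>n. T f n + T g n)) \<and>
     (\<forall>a. \<forall>f\<in>l2. T (\<lambda>n. a * f n) = (\<lambda>n. a * T f n)) \<and>
     (\<exists>K. \<forall>f\<in>l2. l2norm (T f) \<le> K * l2norm f)"

definition Spec :: "((int \<Rightarrow> complex) \<Rightarrow> (int \<Rightarrow> complex)) \<Rightarrow> complex set" where
  "Spec T = {z. \<not> (\<exists>R. bounded_operator R \<and>
     (\<forall>f\<in>l2. R (\<lambda>n. T f n - z * f n) = f) \<and>
     (\<forall>f\<in>l2. (\<lambda>n. T (R f) n - z * R f n) = f))}"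


section \<open>Pseudo-ergodic sequences and their operators\<close>

definition Omega :: "(int \<Rightarrow> int) set" where
  "Omega = {c. \<forall>n. c n \<in> {1, -1}}"

definition A :: "(int \<Rightarrow> int) \<Rightarrow> (int \<Rightarrow> complex) \<Rightarrow> (int \<Rightarrow> complex)" where
  "A c f = (\<lambda>n. of_int (c n) * f (n - 1) + f (n + 1))"

text \<open>A finite sequence of length \<open>n\<close> is a function on \<^typ>\<open>nat\<close> of which only the values
  on \<open>{1..n}\<close> are used. The common spectrum \<open>S\<close> of the operators \<open>A c\<close> with \<open>c\<close> pseudo-ergodic is
  written \<open>Spec (A c)\<close> for an arbitrary such \<open>c\<close>; one exists by \<open>ex_pseudo_ergodic\<close>
  below.\<close>
definition pseudo_ergodic :: "(int \<Rightarrow> int) \<Rightarrow> bool" where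
  "pseudo_ergodic c \<longleftrightarrow> c \<in> Omega \<and>
     (\<forall>n. \<forall>b :: nat \<Rightarrow> int. (\<forall>r\<in>{1..n}. b r \<in> {1, -1}) \<longrightarrow>
        (\<exists>m :: int. \<forall>r\<in>{1..n}. b r = c (m + int r)))"

definition scaled_interval :: "complex \<Rightarrow> real set \<Rightarrow> complex set" where
  "scaled_interval z J = {z * of_real t |t. t \<in> J}"


section \<open>Sanity checks\<close>

lemma bounded_operator_A:
  assumes "c \<in> Omega"
  shows "bounded_operator (A c)"
proof -
  have sh: "((\<lambda>n. (cmod (f (n + k)))\<^sup>2) summable_on UNIV) \<and>
      (\<Sum>\<^sub>\<infinity>n. (cmod (f (n + k)))\<^sup>2) = (\<Sum>\<^sub>\<infinity>n. (cmod (f n))\<^sup>2)"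
    if "f \<in> l2" for f and k :: int
  proof -
    have b: "bij_betw (\<lambda>n. n + k) UNIV UNIV"
      by (rule bij_betw_byWitness[where f' = "\<lambda>n. n - k"]) auto
    show ?thesis
      using summable_on_reindex_bij_betw[OF b, of "\<lambda>n. (cmod (f n))\<^sup>2"]
        infsum_reindex_bij_betw[OF b, of "\<lambda>n. (cmod (f n))\<^sup>2"] that
      by (simp add: l2_def)
  qed
  have pt: "(cmod (A c f n))\<^sup>2 \<le> 2 * (cmod (f (n + (-1))))\<^sup>2 + 2 * (cmod (f (n + 1)))\<^sup>2" for f n
  proof -
    have "cmod (of_int (c n)) = 1"
      using assms unfolding Omega_def by (cases "c n = 1") auto
    then have "cmod (A c f n) \<le> cmod (f (n - 1)) + cmod (f (n + 1))"
      unfolding A_def by (metis norm_mult norm_triangle_ineq mult_1)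
    then have "(cmod (A c f n))\<^sup>2 \<le> (cmod (f (n - 1)) + cmod (f (n + 1)))\<^sup>2"
      by (rule power_mono) simp
    also have "\<dots> \<le> 2 * (cmod (f (n - 1)))\<^sup>2 + 2 * (cmod (f (n + 1)))\<^sup>2"
      using zero_le_power2[of "cmod (f (n - 1)) - cmod (f (n + 1))"]
      by (simp add: power2_eq_square algebra_simps)
    finally show ?thesis by simp
  qed
  have main: "A c f \<in> l2 \<and> l2norm (A c f) \<le> 2 * l2norm f" if f: "f \<in> l2" for f
  proof -
    let ?h = "\<lambda>n. 2 * (cmod (f (n + (-1))))\<^sup>2 + 2 * (cmod (f (n + 1)))\<^sup>2"
    have s1: "(\<lambda>n. 2 * (cmod (f (n + (-1))))\<^sup>2) summable_on UNIV"
      and s2: "(\<lambda>n. 2 * (cmod (f (n + 1)))\<^sup>2) summable_on UNIV"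
      by (rule summable_on_cmult_right, use sh[OF f] in blast)+
    have s: "?h summable_on UNIV"
      by (rule summable_on_add[OF s1 s2])
    have A: "(\<lambda>n. (cmod (A c f n))\<^sup>2) summable_on UNIV"
      by (rule summable_on_comparison_test[OF s]) (use pt in auto)
    have "(\<Sum>\<^sub>\<infinity>n. (cmod (A c f n))\<^sup>2) \<le> (\<Sum>\<^sub>\<infinity>n. ?h n)"
      by (rule infsum_mono[OF A s]) (rule pt)
    also have "\<dots> = 4 * (\<Sum>\<^sub>\<infinity>n. (cmod (f n))\<^sup>2)"
      using sh[OF f, of "-1"] sh[OF f, of 1]
      by (subst infsum_add[OF s1 s2]) (simp add: infsum_cmult_right')
    finally have "l2norm (A c f) \<le> sqrt (4 * (\<Sum>\<^sub>\<infinity>n. (cmod (f n))\<^sup>2))"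
      unfolding l2norm_def by (rule real_sqrt_le_mono)
    then show ?thesis using A by (simp add: l2_def l2norm_def real_sqrt_mult)
  qed
  show ?thesis
    unfolding bounded_operator_def
  proof (intro conjI)
    show "\<forall>f\<in>l2. A c f \<in> l2" using main by blast
    show "\<exists>K. \<forall>f\<in>l2. l2norm (A c f) \<le> K * l2norm f" using main by blast
  qed (auto simp: A_def algebra_simps)
qed

lemma ex_pseudo_ergodic: "\<exists>c. pseudo_ergodic c"
proof -
  text \<open>The block of positions from \<open>2 ^ k\<close> to \<open>2 ^ (k + 1) - 1\<close> starts with the binary digits
    of \<open>k\<close>.\<close>
  define c :: "int \<Rightarrow> int" where
    "c = (\<lambda>p. if bit (floor_log (nat p)) (nat p - 2 ^ floor_log (nat p)) then 1 else -1)"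
  have "\<exists>m :: int. \<forall>r\<in>{1..n}. b r = c (m + int r)"
    if b: "\<forall>r\<in>{1..n}. b r \<in> {1, -1}" for n and b :: "nat \<Rightarrow> int"
  proof -
    define xs where "xs = map (\<lambda>i. b (Suc i) = 1) [0..<n] @ [True]"
    define k :: nat where "k = horner_sum of_bool 2 xs"
    have bk: "bit k i \<longleftrightarrow> i < length xs \<and> xs ! i" for i
      unfolding k_def by (simp add: bit_horner_sum_bit_iff)
    have "bit k n"
      unfolding bk by (simp add: xs_def nth_append)
    then have "2 ^ n \<le> k"
      by (metis bit_iff_odd div_less dvd_0_right not_le)
    then have nk: "n < 2 ^ k"
      using less_exp[of n] less_exp[of k] by linarith
    have "b r = c (int (2 ^ k) - 1 + int r)" if r: "r \<in> {1..n}" for r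
    proof -
      obtain i where i: "r = Suc i" "i < n" using r by (cases r) auto
      have p: "nat (int (2 ^ k) - 1 + int r) = 2 ^ k + i"
        using i by (simp add: nat_add_distrib nat_power_eq)
      have fl: "floor_log (2 ^ k + i) = k"
        by (rule floor_log_eqI) (use i nk in auto)
      have "bit k i \<longleftrightarrow> b r = 1"
        unfolding bk using i by (simp add: xs_def nth_append)
      then show ?thesis
        unfolding c_def p fl using b r by auto
    qed
    then show ?thesis by blast
  qed
  then have "pseudo_ergodic c"
    unfolding pseudo_ergodic_def Omega_def by (auto simp: c_def)
  then show ?thesis by blast
qed

end

theory Submission
  imports Defs
begin

text \<open>
  The proof works with approximate eigenvalues of the whole family \<open>A b\<close>, \<open>b \<in> Omega\<close>: numbers
  \<open>z\<close> for which some finitely supported \<open>f\<close> makes \<open>A b f - z f\<close> as small as desired in comparison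
  with \<open>f\<close>, where \<open>b\<close> may depend on the precision. Finite support is what makes this notion fit
  pseudo-ergodicity: only finitely many entries of \<open>b\<close> matter to \<open>f\<close>, a pseudo-ergodic \<open>c\<close> contains
  them as a block, and a translate of \<open>f\<close> is then an equally good approximate eigenvector of
  \<open>A c\<close>. So every approximate eigenvalue of the family lies in the spectrum
  (\<open>approx_eigenvalue_in_Spec\<close>).

  Three facts produce enough of them. First, truncated plane waves for the two constant sequences
  give the segments \<open>[-2, 2]\<close> and \<open>\<i> [-2, 2]\<close>. Secondly, the set is closed under square roots
  (\<open>approx_eigenvalue_sqrt\<close>). Indeed
  \[ (A_c^2 g)_n = c_n c_{n-1} g_{n-2} + (c_n + c_{n+1}) g_n + g_{n+2} , \]
  and for every \<open>b\<close> there is a \<open>c\<close> whose square acts on the even sites exactly as \<open>A b\<close>; then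
  \<open>A b - z\<^sup>2\<close> becomes the product of \<open>A c - z\<close> and \<open>A c + z\<close>, one of which has to be small.
  Taking square roots \<open>n\<close> times turns the two segments into the rays of the theorem. Thirdly, the
  set is closed in the plane. The arguments \<open>\<pi> r / 2 ^ (n + 1)\<close> become dense as \<open>n\<close> grows and each
  ray has length at least 1, so the closure of the union of the rays contains the unit disc.
\<close>

section \<open>Squared norms\<close>

definition sqnorm :: "(int \<Rightarrow> complex) \<Rightarrow> real" where
  "sqnorm f = (\<Sum>\<^sub>\<infinity>n. (cmod (f n))\<^sup>2)"

definition finsupp :: "(int \<Rightarrow> complex) \<Rightarrow> bool" where
  "finsupp f \<longleftrightarrow> finite {n. f n \<noteq> 0}"

lemma finsuppI:
  assumes "finite F" "\<And>n. n \<notin> F \<Longrightarrow> f n = 0"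
  shows "finsupp f"
  unfolding finsupp_def by (rule finite_subset[OF _ assms(1)]) (use assms(2) in auto)

lemma sqnorm_eq_sum:
  assumes "finite F" "\<And>n. n \<notin> F \<Longrightarrow> f n = 0"
  shows "sqnorm f = (\<Sum>n\<in>F. (cmod (f n))\<^sup>2)"
proof -
  have "sqnorm f = (\<Sum>\<^sub>\<infinity>n\<in>F. (cmod (f n))\<^sup>2)"
    unfolding sqnorm_def by (rule infsum_cong_neutral) (use assms in auto)
  then show ?thesis using assms(1) by simp
qed

lemma finsupp_summable:
  assumes "finsupp f"
  shows "(\<lambda>n. (cmod (f n))\<^sup>2) summable_on UNIV"
proof -
  have "(\<lambda>n. (cmod (f n))\<^sup>2) summable_on {n. f n \<noteq> 0}"
    using assms by (simp add: finsupp_def)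
  then show ?thesis
    by (rule summable_on_cong_neutral[THEN iffD1, rotated -1]) auto
qed

lemma finsupp_in_l2: "finsupp f \<Longrightarrow> f \<in> l2"
  by (simp add: l2_def finsupp_summable)

lemma sqnorm_nonneg: "0 \<le> sqnorm f"
  unfolding sqnorm_def by (rule infsum_nonneg) simp

lemma l2norm_eq_sqrt_sqnorm: "l2norm f = sqrt (sqnorm f)"
  by (simp add: l2norm_def sqnorm_def)

lemma finsupp_shift:
  assumes "finsupp f"
  shows "finsupp (\<lambda>n. f (n + k))"
proof (rule finsuppI)
  show "finite ((\<lambda>n. n - k) ` {n. f n \<noteq> 0})"
    using assms by (simp add: finsupp_def)
  show "f (n + k) = 0" if "n \<notin> (\<lambda>n. n - k) ` {n. f n \<noteq> 0}" for n
    using that by (force simp: image_iff)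
qed

lemma sqnorm_shift: "sqnorm (\<lambda>n. f (n + k)) = sqnorm f"
proof -
  have "bij_betw (\<lambda>n. n + k) UNIV UNIV"
    by (rule bij_betw_byWitness[where f' = "\<lambda>n. n - k"]) auto
  then show ?thesis
    unfolding sqnorm_def
    using infsum_reindex_bij_betw[of "\<lambda>n. n + k" UNIV UNIV "\<lambda>n. (cmod (f n))\<^sup>2"] by simp
qed

lemma finsupp_lin:
  assumes "finsupp f" "finsupp g"
  shows "finsupp (\<lambda>n. f n + w * g n)"
  by (rule finsuppI[of "{n. f n \<noteq> 0} \<union> {n. g n \<noteq> 0}"]) (use assms in \<open>auto simp: finsupp_def\<close>)

lemma finsupp_A:
  assumes "finsupp f"
  shows "finsupp (A c f)"
proof (rule finsuppI)
  show "finite ({n. f (n + (-1)) \<noteq> 0} \<union> {n. f (n + 1) \<noteq> 0})"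
    using finsupp_shift[OF assms, of "-1"] finsupp_shift[OF assms, of 1] by (simp add: finsupp_def)
qed (auto simp: A_def)

lemma sqnorm_lin_le:
  assumes "finsupp f" "finsupp g"
  shows "sqnorm (\<lambda>n. f n + w * g n) \<le> 2 * sqnorm f + 2 * (cmod w)\<^sup>2 * sqnorm g"
proof -
  let ?F = "{n. f n \<noteq> 0} \<union> {n. g n \<noteq> 0}"
  have F: "finite ?F" using assms by (simp add: finsupp_def)
  have "(cmod (f n + w * g n))\<^sup>2 \<le> 2 * (cmod (f n))\<^sup>2 + 2 * (cmod w)\<^sup>2 * (cmod (g n))\<^sup>2" for n
  proof -
    have "(cmod (f n + w * g n))\<^sup>2 \<le> (cmod (f n) + cmod w * cmod (g n))\<^sup>2"
      by (rule power_mono) (metis norm_mult norm_triangle_ineq, simp)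
    also have "\<dots> \<le> 2 * (cmod (f n))\<^sup>2 + 2 * (cmod w)\<^sup>2 * (cmod (g n))\<^sup>2"
      using zero_le_power2[of "cmod (f n) - cmod w * cmod (g n)"]
      by (simp add: power2_eq_square algebra_simps)
    finally show ?thesis .
  qed
  then have "(\<Sum>n\<in>?F. (cmod (f n + w * g n))\<^sup>2)
      \<le> (\<Sum>n\<in>?F. 2 * (cmod (f n))\<^sup>2 + 2 * (cmod w)\<^sup>2 * (cmod (g n))\<^sup>2)"
    by (rule sum_mono)
  moreover have "sqnorm f = (\<Sum>n\<in>?F. (cmod (f n))\<^sup>2)" "sqnorm g = (\<Sum>n\<in>?F. (cmod (g n))\<^sup>2)"
    "sqnorm (\<lambda>n. f n + w * g n) = (\<Sum>n\<in>?F. (cmod (f n + w * g n))\<^sup>2)"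
    by (rule sqnorm_eq_sum[OF F], simp)+
  ultimately show ?thesis
    by (simp add: sum.distrib sum_distrib_left)
qed

lemma sqnorm_even_sites:
  assumes "\<And>m. g (2 * m) = f m" "\<And>m. g (2 * m + 1) = 0"
  shows "sqnorm g = sqnorm f"
proof -
  have "g n = 0" if "n \<notin> range (\<lambda>m. 2 * m)" for n
  proof -
    have "odd n" using that by (auto elim: evenE)
    then show ?thesis using assms(2) by (auto elim: oddE)
  qed
  then have "sqnorm g = (\<Sum>\<^sub>\<infinity>n\<in>range (\<lambda>m. 2 * m). (cmod (g n))\<^sup>2)"
    unfolding sqnorm_def by (intro infsum_cong_neutral) auto
  also have "\<dots> = sqnorm f"
    by (subst infsum_reindex) (auto simp: inj_on_def sqnorm_def o_def assms(1))
  finally show ?thesis .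
qed

section \<open>Approximate eigenvalues of the family of hopping operators\<close>

text \<open>The sequence \<open>b\<close> is chosen after the precision \<open>\<epsilon>\<close>, so no single \<open>A b\<close> has to have \<open>z\<close>
  in its spectrum by definition.\<close>
definition approx_eigenvalue :: "complex \<Rightarrow> bool" where
  "approx_eigenvalue z \<longleftrightarrow> (\<forall>\<epsilon>>0. \<exists>b\<in>Omega. \<exists>f. finsupp f \<and> 0 < sqnorm f \<and>
     sqnorm (\<lambda>n. A b f n - z * f n) \<le> \<epsilon> * sqnorm f)"

text \<open>An operator with bounded inverse is bounded below, which approximate eigenvectors of arbitrary
  precision prevent.\<close>
lemma Spec_if_not_bounded_below:
  assumes "\<And>\<epsilon>. \<epsilon> > 0 \<Longrightarrow> \<exists>f. finsupp f \<and> 0 < sqnorm f \<and>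
     sqnorm (\<lambda>n. A c f n - z * f n) \<le> \<epsilon> * sqnorm f"
  shows "z \<in> Spec (A c)"
proof (rule ccontr)
  assume "z \<notin> Spec (A c)"
  then obtain R where R: "bounded_operator R"
    and inv: "\<And>f. f \<in> l2 \<Longrightarrow> R (\<lambda>n. A c f n - z * f n) = f"
    unfolding Spec_def by blast
  from R obtain K where K: "\<And>f. f \<in> l2 \<Longrightarrow> l2norm (R f) \<le> K * l2norm f"
    unfolding bounded_operator_def by blast
  define \<epsilon> where "\<epsilon> = 1 / (K\<^sup>2 + 1)"
  have pos: "K\<^sup>2 + 1 > 0" by (simp add: add_nonneg_pos)
  then have "\<epsilon> > 0" by (simp add: \<epsilon>_def)
  from assms[OF this] obtain f where f: "finsupp f" "0 < sqnorm f"
    and le: "sqnorm (\<lambda>n. A c f n - z * f n) \<le> \<epsilon> * sqnorm f" by blast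
  let ?g = "\<lambda>n. A c f n - z * f n"
  have "finsupp ?g" using finsupp_lin[OF finsupp_A[OF f(1)] f(1), of c "- z"] by simp
  then have "l2norm (R ?g) \<le> K * l2norm ?g" by (intro K finsupp_in_l2)
  then have "sqrt (sqnorm f) \<le> K * sqrt (sqnorm ?g)"
    unfolding inv[OF finsupp_in_l2[OF f(1)]] l2norm_eq_sqrt_sqnorm .
  then have "(sqrt (sqnorm f))\<^sup>2 \<le> (K * sqrt (sqnorm ?g))\<^sup>2"
    by (rule power_mono) (simp add: sqnorm_nonneg)
  then have "sqnorm f \<le> K\<^sup>2 * sqnorm ?g"
    by (simp add: power_mult_distrib sqnorm_nonneg)
  also have "\<dots> \<le> K\<^sup>2 * (\<epsilon> * sqnorm f)" by (intro mult_left_mono le) simp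
  also have "\<dots> = (K\<^sup>2 * \<epsilon>) * sqnorm f" by simp
  also have "\<dots> < 1 * sqnorm f"
    using pos f(2) by (intro mult_strict_right_mono) (simp_all add: \<epsilon>_def field_simps)
  finally show False by simp
qed

lemma pseudo_ergodic_window:
  assumes "pseudo_ergodic c" "b \<in> Omega"
  shows "\<exists>k. \<forall>n\<in>{-N..N}. b n = c (n + k)"
proof -
  define d where "d r = b (int r - N - 1)" for r :: nat
  have "\<forall>r\<in>{1..nat (2 * N + 1)}. d r \<in> {1, -1}"
    using assms(2) by (simp add: Omega_def d_def)
  then obtain m where m: "\<forall>r\<in>{1..nat (2 * N + 1)}. d r = c (m + int r)"
    using assms(1) unfolding pseudo_ergodic_def by blast
  have "b n = c (n + (m + N + 1))" if "n \<in> {-N..N}" for n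
  proof -
    have "nat (n + N + 1) \<in> {1..nat (2 * N + 1)}" using that by auto
    then have "d (nat (n + N + 1)) = c (m + int (nat (n + N + 1)))" using m by blast
    then show ?thesis using that by (simp add: d_def algebra_simps)
  qed
  then show ?thesis by blast
qed

text \<open>Translate an approximate eigenvector of \<open>A b\<close> to a place where \<open>c\<close> repeats the entries
  of \<open>b\<close> that the vector sees.\<close>
lemma approx_eigenvalue_in_Spec:
  assumes c: "pseudo_ergodic c" and z: "approx_eigenvalue z"
  shows "z \<in> Spec (A c)"
proof (rule Spec_if_not_bounded_below)
  fix \<epsilon> :: real
  assume "\<epsilon> > 0"
  then obtain b f where b: "b \<in> Omega" and f: "finsupp f" "0 < sqnorm f"
    and le: "sqnorm (\<lambda>n. A b f n - z * f n) \<le> \<epsilon> * sqnorm f"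
    using z unfolding approx_eigenvalue_def by blast
  obtain N where N: "\<And>n. f n \<noteq> 0 \<Longrightarrow> \<bar>n\<bar> \<le> N"
  proof -
    have "finite (abs ` {n. f n \<noteq> 0})" using f(1) by (simp add: finsupp_def)
    then have "bdd_above (abs ` {n. f n \<noteq> 0})" by (rule bdd_above_finite)
    then show ?thesis using that by (auto simp: bdd_above_def)
  qed
  \<comment> \<open>The entry \<open>b n\<close> multiplies \<open>f (n - 1)\<close>, hence the window is one larger than the support.\<close>
  obtain k where k: "\<forall>n\<in>{-(N + 1)..N + 1}. b n = c (n + k)"
    using pseudo_ergodic_window[OF c b] by blast
  define g where "g = (\<lambda>n. f (n + (- k)))"
  have "A c g n - z * g n = A b f (n + (- k)) - z * f (n + (- k))" for n
  proof (cases "f (n - k - 1) = 0")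
    case True
    then show ?thesis by (simp add: A_def g_def algebra_simps)
  next
    case False
    then have "n - k \<in> {-(N + 1)..N + 1}" using N[of "n - k - 1"] by auto
    then have "b (n - k) = c n" using k by fastforce
    then show ?thesis by (simp add: A_def g_def algebra_simps)
  qed
  then have "sqnorm (\<lambda>n. A c g n - z * g n) = sqnorm (\<lambda>n. A b f n - z * f n)"
    using sqnorm_shift[of "\<lambda>n. A b f n - z * f n" "- k"] by simp
  moreover have "sqnorm g = sqnorm f" unfolding g_def by (rule sqnorm_shift)
  moreover have "finsupp g" unfolding g_def by (rule finsupp_shift[OF f(1)])
  ultimately show "\<exists>f. finsupp f \<and> 0 < sqnorm f \<and>
      sqnorm (\<lambda>n. A c f n - z * f n) \<le> \<epsilon> * sqnorm f"
    using f(2) le by (intro exI[of _ g]) simp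
qed

lemma approx_eigenvalue_limit:
  assumes "\<And>n :: nat. approx_eigenvalue (w n)" "w \<longlonglongrightarrow> z"
  shows "approx_eigenvalue z"
  unfolding approx_eigenvalue_def
proof (intro allI impI)
  fix \<epsilon> :: real
  assume \<epsilon>: "\<epsilon> > 0"
  have "(\<lambda>n. (cmod (w n - z))\<^sup>2) \<longlonglongrightarrow> (cmod (z - z))\<^sup>2"
    by (intro tendsto_intros assms(2))
  then have "(\<lambda>n. (cmod (w n - z))\<^sup>2) \<longlonglongrightarrow> 0" by simp
  then have "\<forall>\<^sub>F n in sequentially. (cmod (w n - z))\<^sup>2 < \<epsilon> / 4"
    by (rule order_tendstoD(2)) (use \<epsilon> in simp)
  then obtain n where n: "(cmod (w n - z))\<^sup>2 < \<epsilon> / 4"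
    using eventually_happens'[OF sequentially_bot] by blast
  have "\<epsilon> / 4 > 0" using \<epsilon> by simp
  then obtain b f where b: "b \<in> Omega" and f: "finsupp f" "0 < sqnorm f"
    and le: "sqnorm (\<lambda>k. A b f k - w n * f k) \<le> \<epsilon> / 4 * sqnorm f"
    using assms(1)[of n] unfolding approx_eigenvalue_def by blast
  have fs: "finsupp (\<lambda>k. A b f k - w n * f k)"
    using finsupp_lin[OF finsupp_A[OF f(1)] f(1), of b "- w n"] by simp
  have "sqnorm (\<lambda>k. A b f k - z * f k)
      = sqnorm (\<lambda>k. (A b f k - w n * f k) + (w n - z) * f k)"
    by (simp add: algebra_simps)
  also have "\<dots> \<le> 2 * sqnorm (\<lambda>k. A b f k - w n * f k) + 2 * (cmod (w n - z))\<^sup>2 * sqnorm f"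
    by (rule sqnorm_lin_le[OF fs f(1)])
  also have "\<dots> \<le> 2 * (\<epsilon> / 4 * sqnorm f) + 2 * (\<epsilon> / 4) * sqnorm f"
    using n f(2) by (intro add_mono mult_left_mono mult_right_mono le) auto
  also have "\<dots> = \<epsilon> * sqnorm f" by simp
  finally show "\<exists>b\<in>Omega. \<exists>f. finsupp f \<and> 0 < sqnorm f \<and>
      sqnorm (\<lambda>n. A b f n - z * f n) \<le> \<epsilon> * sqnorm f"
    using b f by blast
qed

section \<open>The constant sequences\<close>

text \<open>The plane wave \<open>w ^ n\<close> solves the eigenvalue equation of the constant sequence \<open>s\<close> exactly.
  Cutting it off to \<open>N\<close> sites creates four boundary errors of modulus 1, while its squared norm is
  \<open>N\<close>.\<close>
lemma approx_eigenvalue_plane_wave: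
  fixes s :: int and w :: complex
  assumes s: "s \<in> {1, -1}" and w: "cmod w = 1"
  shows "approx_eigenvalue (of_int s / w + w)"
  unfolding approx_eigenvalue_def
proof (intro allI impI)
  fix \<epsilon> :: real
  assume \<epsilon>: "\<epsilon> > 0"
  obtain M :: nat where M: "4 / \<epsilon> < real M" using reals_Archimedean2 by blast
  define N where "N = int M + 2"
  have N: "N \<ge> 2" "4 \<le> \<epsilon> * of_int N"
    using M \<epsilon> by (simp_all add: N_def field_simps)
  define f where "f = (\<lambda>n. if n \<in> {0..<N} then w powi n else 0)"
  let ?g = "\<lambda>n. A (\<lambda>_. s) f n - (of_int s / w + w) * f n"
  have w0: "w \<noteq> 0" using w by auto
  have cm: "cmod (w powi n) = 1" for n using w by (simp add: norm_power_int)
  have cs: "cmod (of_int s) = 1" using s by auto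
  have "sqnorm f = (\<Sum>n\<in>{0..<N}. (cmod (f n))\<^sup>2)"
    by (rule sqnorm_eq_sum) (auto simp: f_def)
  also have "\<dots> = of_int N" using N by (simp add: f_def cm)
  finally have sf: "sqnorm f = of_int N" .
  let ?B = "{-1, 0, N - 1, N}"
  have shift: "w powi (n + 1) = w * w powi n" "w powi (n - 1) = w powi n / w" for n
    using w0 by (simp_all add: power_int_add power_int_diff)
  have out: "?g n = 0" if "n \<notin> ?B" for n
  proof -
    have "n < -1 \<or> n > N \<or> (0 \<le> n - 1 \<and> n + 1 < N)" using that by auto
    then show ?thesis
      using N by (auto simp: f_def A_def shift distrib_right)
  qed
  have bd: "(cmod (?g n))\<^sup>2 \<le> 1" if "n \<in> ?B" for n
  proof -
    consider "n = -1" | "n = 0" | "n = N - 1" | "n = N" using \<open>n \<in> ?B\<close> by blast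
    then have "cmod (?g n) = 1"
    proof cases
      case 1
      then show ?thesis using N by (simp add: f_def A_def)
    next
      case 2
      then show ?thesis using N cs w by (simp add: f_def A_def norm_divide)
    next
      case 3
      have "?g n = - (w * w powi n)"
        using N 3 by (simp add: f_def A_def shift(2)[of n] algebra_simps)
      then show ?thesis using w cm by (simp add: norm_mult)
    next
      case 4
      then show ?thesis using N cs cm by (simp add: f_def A_def norm_mult)
    qed
    then show ?thesis by simp
  qed
  have "sqnorm ?g = (\<Sum>n\<in>?B. (cmod (?g n))\<^sup>2)"
    by (rule sqnorm_eq_sum) (use out in auto)
  also have "\<dots> \<le> of_nat (card ?B) * 1" by (rule sum_bounded_above) (rule bd)
  also have "\<dots> = 4" using N by simp
  also have "\<dots> \<le> \<epsilon> * sqnorm f" using N sf by simp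
  finally have "sqnorm ?g \<le> \<epsilon> * sqnorm f" .
  moreover have "finsupp f" by (rule finsuppI[of "{0..<N}"]) (auto simp: f_def)
  moreover have "0 < sqnorm f" using N sf by simp
  moreover have "(\<lambda>_. s) \<in> Omega" using s by (simp add: Omega_def)
  ultimately show "\<exists>b\<in>Omega. \<exists>f. finsupp f \<and> 0 < sqnorm f \<and>
      sqnorm (\<lambda>n. A b f n - (of_int s / w + w) * f n) \<le> \<epsilon> * sqnorm f"
    by blast
qed

lemma approx_eigenvalue_real:
  assumes "\<bar>x\<bar> \<le> 2"
  shows "approx_eigenvalue (of_real x)"
proof -
  let ?t = "arccos (x / 2)"
  have "cos ?t = x / 2" using assms by (intro cos_arccos) auto
  then have "of_int 1 / cis ?t + cis ?t = of_real x"
    by (simp add: complex_eq_iff flip: cis_inverse divide_inverse inverse_eq_divide)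
  then show ?thesis
    using approx_eigenvalue_plane_wave[of 1 "cis ?t"] by simp
qed

lemma approx_eigenvalue_imaginary:
  assumes "\<bar>x\<bar> \<le> 2"
  shows "approx_eigenvalue (\<i> * of_real x)"
proof -
  let ?t = "arcsin (x / 2)"
  have "sin ?t = x / 2" using assms by (intro sin_arcsin) auto
  then have "of_int (-1) / cis ?t + cis ?t = \<i> * of_real x"
    by (simp add: complex_eq_iff flip: cis_inverse divide_inverse inverse_eq_divide)
  then show ?thesis
    using approx_eigenvalue_plane_wave[of "-1" "cis ?t"] by simp
qed

section \<open>Square roots\<close>

text \<open>By the formula for the square of \<open>A c\<close>, its action on the even sites has no diagonal term if
  \<open>c\<close> changes sign from each even site to the next, and has the entries of \<open>b\<close> as coefficients if
  \<open>c (2 * m) * c (2 * m - 1) = b m\<close>. These two conditions determine \<open>c\<close> recursively in both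
  directions from \<open>c 0\<close>.\<close>
lemma ex_square_root_sequence:
  assumes "b \<in> Omega"
  shows "\<exists>c\<in>Omega. \<forall>m. c (2 * m + 1) = - c (2 * m) \<and> c (2 * m) * c (2 * m - 1) = b m"
proof -
  have b: "b m = 1 \<or> b m = -1" for m using assms by (auto simp: Omega_def)
  \<comment> \<open>The entries of \<open>c\<close> at the even sites: a solution of \<open>e m = - b m * e (m - 1)\<close> with
    \<open>e 0 = 1\<close>. For every \<open>m\<close> at least one of the two products is empty.\<close>
  define e where "e m = (\<Prod>i\<in>{1..m}. - b i) * (\<Prod>i\<in>{m<..0}. - b i)" for m
  have unit: "(\<Prod>i\<in>I. - b i) = 1 \<or> (\<Prod>i\<in>I. - b i) = -1" if "finite I" for I
    using that
  proof (induction I rule: finite_induct)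
    case (insert i I)
    then show ?case using b[of i] by auto
  qed simp
  have e: "e m = 1 \<or> e m = -1" for m
    using unit[of "{1..m}"] unit[of "{m<..0}"] by (auto simp: e_def)
  have rec: "e m = - b m * e (m - 1)" for m
  proof (cases "m \<ge> 1")
    case True
    then have "{1..m} = insert m {1..m - 1}" "{m<..0} = {}" "{m - 1<..0} = {}" by auto
    then show ?thesis by (simp add: e_def)
  next
    case False
    then have I: "{m - 1<..0} = insert m {m<..0}" "{1..m} = {}" "{1..m - 1} = {}" by auto
    have "e (m - 1) = - b m * e m" by (simp add: e_def I)
    then show ?thesis using b[of m] by auto
  qed
  define c where "c n = (if even n then e (n div 2) else - e (n div 2))" for n
  have "c \<in> Omega" using e by (auto simp: Omega_def c_def)
  moreover have "c (2 * m + 1) = - c (2 * m)" for m by (simp add: c_def)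
  moreover have "c (2 * m) * c (2 * m - 1) = b m" for m
  proof -
    have "(2 * m - 1) div 2 = m - 1" by simp
    then have "c (2 * m) * c (2 * m - 1) = - (e m * e (m - 1))" by (simp add: c_def)
    then show ?thesis using rec[of m] e[of "m - 1"] by auto
  qed
  ultimately show ?thesis by blast
qed

text \<open>Let \<open>g\<close> carry an approximate eigenvector of \<open>A b\<close> for \<open>z\<^sup>2\<close> on the even sites, with \<open>c\<close>
  the square root sequence of \<open>b\<close>. Then \<open>A c - z\<close> maps \<open>h = A c g + z g\<close> to a small vector, so
  \<open>h\<close> is an approximate eigenvector for \<open>z\<close> unless \<open>h\<close> itself is small. In that case \<open>g\<close> is one for
  \<open>- z\<close>, and therefore also for \<open>z\<close>, because \<open>A c g\<close> and \<open>g\<close> have disjoint supports.\<close>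
lemma approx_eigenvalue_sqrt:
  assumes "approx_eigenvalue (z\<^sup>2)"
  shows "approx_eigenvalue z"
  unfolding approx_eigenvalue_def
proof (intro allI impI)
  fix \<epsilon> :: real
  assume \<epsilon>: "\<epsilon> > 0"
  then have "\<epsilon>\<^sup>2 > 0" by simp
  then obtain b f where b: "b \<in> Omega" and f: "finsupp f" "0 < sqnorm f"
    and le: "sqnorm (\<lambda>n. A b f n - z\<^sup>2 * f n) \<le> \<epsilon>\<^sup>2 * sqnorm f"
    using assms unfolding approx_eigenvalue_def by blast
  obtain c where c: "c \<in> Omega" and c1: "\<And>m. c (2 * m + 1) = - c (2 * m)"
    and c2: "\<And>m. c (2 * m) * c (2 * m - 1) = b m"
    using ex_square_root_sequence[OF b] by blast
  define g where "g n = (if even n then f (n div 2) else 0)" for n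
  define h where "h n = A c g n + z * g n" for n
  have ge: "g (2 * m) = f m" and go: "g (2 * m + 1) = 0" for m by (simp_all add: g_def)
  have sg: "sqnorm g = sqnorm f" by (rule sqnorm_even_sites) (simp_all add: ge go)
  have fg: "finsupp g"
  proof (rule finsuppI)
    show "finite ((\<lambda>m. 2 * m) ` {n. f n \<noteq> 0})" using f(1) by (simp add: finsupp_def)
    show "g n = 0" if "n \<notin> (\<lambda>m. 2 * m) ` {n. f n \<noteq> 0}" for n
      using that by (auto simp: g_def image_iff elim: evenE)
  qed
  have fh: "finsupp h" unfolding h_def by (rule finsupp_lin[OF finsupp_A[OF fg] fg])
  have he: "h (2 * m) = z * f m" for m
    by (simp add: h_def A_def g_def)
  have ho: "h (2 * m + 1) = of_int (c (2 * m + 1)) * f m + f (m + 1)" for m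
    by (simp add: h_def A_def g_def add.commute)
  have ke: "A c h (2 * m) - z * h (2 * m) = A b f m - z\<^sup>2 * f m" for m
  proof -
    have "A c h (2 * m) = of_int (c (2 * m)) * h (2 * (m - 1) + 1) + h (2 * m + 1)"
      by (simp add: A_def)
    also have "\<dots> = of_int (c (2 * m) * c (2 * m - 1)) * f (m - 1)
        + (of_int (c (2 * m)) + of_int (c (2 * m + 1))) * f m + f (m + 1)"
      using ho[of "m - 1"] ho[of m] by (simp add: algebra_simps)
    also have "\<dots> = A b f m" by (simp only: c1 c2) (simp add: A_def)
    finally show ?thesis by (simp add: he power2_eq_square)
  qed
  have ko: "A c h (2 * m + 1) - z * h (2 * m + 1) = 0" for m
    unfolding ho using he[of m] he[of "m + 1"] by (simp add: A_def algebra_simps)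
  have sk: "sqnorm (\<lambda>n. A c h n - z * h n) = sqnorm (\<lambda>n. A b f n - z\<^sup>2 * f n)"
    by (rule sqnorm_even_sites) (simp_all only: ke ko)
  have "cmod (A c g n - z * g n) = cmod (h n)" for n
    by (cases "even n") (simp_all add: h_def A_def g_def)
  then have gh: "sqnorm (\<lambda>n. A c g n - z * g n) = sqnorm h"
    by (simp add: sqnorm_def)
  have "\<exists>u. finsupp u \<and> 0 < sqnorm u \<and> sqnorm (\<lambda>n. A c u n - z * u n) \<le> \<epsilon> * sqnorm u"
  proof (cases "sqnorm h \<le> \<epsilon> * sqnorm g")
    case True
    then show ?thesis using fg f(2) sg gh by (intro exI[of _ g]) simp
  next
    case False
    have "sqnorm (\<lambda>n. A c h n - z * h n) \<le> \<epsilon> * (\<epsilon> * sqnorm g)"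
      using le sk sg by (simp add: power2_eq_square)
    also have "\<dots> \<le> \<epsilon> * sqnorm h" using False \<epsilon> by (intro mult_left_mono) auto
    finally have "sqnorm (\<lambda>n. A c h n - z * h n) \<le> \<epsilon> * sqnorm h" .
    moreover have "0 < \<epsilon> * sqnorm g" using \<epsilon> f(2) sg by simp
    ultimately show ?thesis using fh False by (intro exI[of _ h]) auto
  qed
  then show "\<exists>b\<in>Omega. \<exists>f. finsupp f \<and> 0 < sqnorm f \<and>
      sqnorm (\<lambda>n. A b f n - z * f n) \<le> \<epsilon> * sqnorm f"
    using c by blast
qed

lemma approx_eigenvalue_root:
  "approx_eigenvalue (z ^ 2 ^ n) \<Longrightarrow> approx_eigenvalue z"
proof (induction n)
  case (Suc n)
  have "z ^ 2 ^ Suc n = (z ^ 2 ^ n)\<^sup>2" by (simp add: power_mult[symmetric] mult.commute)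
  then show ?case using Suc approx_eigenvalue_sqrt by metis
qed simp

section \<open>The rays and the unit disc\<close>

text \<open>The power \<open>2 ^ n\<close> takes the ray into one of the four half-segments \<open>\<i> ^ r [0, 2]\<close>.\<close>
lemma approx_eigenvalue_ray:
  assumes "0 \<le> t" "t \<le> 2 powr (1 / 2 ^ n)"
  shows "approx_eigenvalue (exp (of_real pi * \<i> * of_nat r / 2 ^ (n + 1)) * of_real t)"
proof (rule approx_eigenvalue_root[of _ n])
  define x where "x = t ^ 2 ^ n"
  have "x \<le> (2 powr (1 / 2 ^ n)) ^ 2 ^ n"
    unfolding x_def by (intro power_mono assms)
  also have "\<dots> = 2" by (simp add: powr_power)
  finally have x: "0 \<le> x" "x \<le> 2" using assms(1) by (simp_all add: x_def)
  have "exp (of_real pi * \<i> * of_nat r / 2 ^ (n + 1)) ^ 2 ^ n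
      = exp (of_nat r * (of_real pi * \<i> / 2))"
    by (simp add: exp_of_nat_mult[symmetric] mult_ac)
  also have "\<dots> = exp (\<i> * of_real (pi / 2)) ^ r"
    by (simp add: mult_ac flip: exp_of_nat_mult)
  also have "\<dots> = \<i> ^ r"
    by (simp only: cis_pi_half flip: cis_conv_exp)
  finally have eq: "(exp (of_real pi * \<i> * of_nat r / 2 ^ (n + 1)) * of_real t) ^ 2 ^ n
      = \<i> ^ r * of_real x"
    by (simp add: power_mult_distrib x_def)
  have "approx_eigenvalue (\<i> ^ r * of_real x)"
  proof (cases "even r")
    case True
    then obtain k where "r = 2 * k" by (rule evenE)
    then have "\<i> ^ r * of_real x = of_real ((-1) ^ k * x)" by (simp add: power_mult)
    moreover have "\<bar>(-1) ^ k * x\<bar> \<le> 2" using x by (simp add: abs_mult power_abs)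
    ultimately show ?thesis using approx_eigenvalue_real by metis
  next
    case False
    then obtain k where "r = 2 * k + 1" by (rule oddE)
    then have "\<i> ^ r * of_real x = \<i> * of_real ((-1) ^ k * x)" by (simp add: power_mult)
    moreover have "\<bar>(-1) ^ k * x\<bar> \<le> 2" using x by (simp add: abs_mult power_abs)
    ultimately show ?thesis using approx_eigenvalue_imaginary by metis
  qed
  then show "approx_eigenvalue
      ((exp (of_real pi * \<i> * of_nat r / 2 ^ (n + 1)) * of_real t) ^ 2 ^ n)"
    unfolding eq .
qed

lemma floor_dyadic_tendsto:
  fixes x :: real
  shows "(\<lambda>n. of_int \<lfloor>x * 2 ^ n\<rfloor> / 2 ^ n) \<longlonglongrightarrow> x"
proof (rule real_tendsto_sandwich)
  show "\<forall>\<^sub>F n in sequentially. x - (1 / 2) ^ n \<le> of_int \<lfloor>x * 2 ^ n\<rfloor> / 2 ^ n"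
  proof (intro always_eventually allI)
    fix n :: nat
    have "x * 2 ^ n - 1 \<le> of_int \<lfloor>x * 2 ^ n\<rfloor>" by linarith
    then have "(x * 2 ^ n - 1) / 2 ^ n \<le> of_int \<lfloor>x * 2 ^ n\<rfloor> / 2 ^ n"
      by (rule divide_right_mono) simp
    then show "x - (1 / 2) ^ n \<le> of_int \<lfloor>x * 2 ^ n\<rfloor> / 2 ^ n"
      by (simp add: diff_divide_distrib power_divide)
  qed
  show "\<forall>\<^sub>F n in sequentially. of_int \<lfloor>x * 2 ^ n\<rfloor> / 2 ^ n \<le> x"
    by (intro always_eventually allI) (simp add: field_simps)
  have "(\<lambda>n. x - (1 / 2) ^ n) \<longlonglongrightarrow> x - 0"
    by (intro tendsto_intros LIMSEQ_power_zero) auto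
  then show "(\<lambda>n. x - (1 / 2) ^ n) \<longlonglongrightarrow> x" by simp
qed simp

lemma approx_eigenvalue_disc:
  assumes "cmod z \<le> 1"
  shows "approx_eigenvalue z"
proof (rule approx_eigenvalue_limit)
  define x where "x = Arg2pi z / pi"
  define w where "w n = exp (of_real pi * \<i> * of_nat (nat \<lfloor>x * 2 ^ (n + 1)\<rfloor>) / 2 ^ (n + 1))
    * of_real (cmod z)" for n :: nat
  have x: "x \<ge> 0" by (simp add: x_def Arg2pi_ge_0)
  show "approx_eigenvalue (w n)" for n
  proof -
    have "cmod z \<le> 2 powr (1 / 2 ^ n)"
      using assms ge_one_powr_ge_zero[of 2 "1 / 2 ^ n"] by simp
    then show ?thesis unfolding w_def by (intro approx_eigenvalue_ray) auto
  qed
  have "w = (\<lambda>n. exp (of_real pi * \<i> * of_real (of_int \<lfloor>x * 2 ^ (n + 1)\<rfloor> / 2 ^ (n + 1)))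
      * of_real (cmod z))"
    using x by (simp add: w_def fun_eq_iff)
  moreover have "(\<lambda>n. exp (of_real pi * \<i> * of_real (of_int \<lfloor>x * 2 ^ (n + 1)\<rfloor> / 2 ^ (n + 1)))
      * of_real (cmod z)) \<longlonglongrightarrow> exp (of_real pi * \<i> * of_real x) * of_real (cmod z)"
    by (intro tendsto_intros LIMSEQ_ignore_initial_segment[OF floor_dyadic_tendsto])
  moreover have "exp (of_real pi * \<i> * of_real x) * of_real (cmod z) = z"
    using Arg2pi_eq[of z] by (simp add: x_def mult_ac)
  ultimately show "w \<longlonglongrightarrow> z" by simp
qed

theorem theorem7:
  fixes c :: "int \<Rightarrow> int"
  assumes "pseudo_ergodic c"
  shows "(\<Union>n :: nat. \<Union>r \<in> {0..2 ^ (n + 2) :: nat}.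
            scaled_interval (exp (of_real pi * \<i> * of_nat r / 2 ^ (n + 1)))
              {0..2 powr (1 / 2 ^ n)}) \<subseteq> Spec (A c)
         \<and> {z. cmod z \<le> 1} \<subseteq> Spec (A c)"
proof
  show "(\<Union>n :: nat. \<Union>r \<in> {0..2 ^ (n + 2) :: nat}.
            scaled_interval (exp (of_real pi * \<i> * of_nat r / 2 ^ (n + 1)))
              {0..2 powr (1 / 2 ^ n)}) \<subseteq> Spec (A c)"
    using approx_eigenvalue_in_Spec[OF assms] approx_eigenvalue_ray
    by (fastforce simp: scaled_interval_def)
  show "{z. cmod z \<le> 1} \<subseteq> Spec (A c)"
    using approx_eigenvalue_in_Spec[OF assms] approx_eigenvalue_disc by blast
qed

end
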